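(* Let $K/k$ be a purely inseparable extension which is both $lq$-finite and modular. Then $K/k$ is $q$-finite.
   Context: All fields are commutative of characteristic $p>0$. A subset $B\subseteq K$ is an $r$-base of an extension $K/k$ if $K=k(K^p)(B)$ and, for every $x\in B$, $x\notin k(K^p)(B\setminus\{x\})$; every extension has an $r$-base and all $r$-bases of a given extension have the same cardinality. For a purely inseparable extension $K/k$ and $n\ge 1$, put $k_n=k^{p^{-n}}\cap K=\{x\in K: x^{p^n}\in k\}$ and let $B_n$ be an $r$-base of $k_n/k$. The degree of irrationality is the cardinal $di(K/k)=\sup_{n\ge 1}|B_n|$. A purely inseparable extension $K/k$ is: $q$-finite if $di(K/k)$ is finite; $lq$-finite if $k_n/k$ is a finite extension for every $n\ge 1$; modular if for every $n\in\mathbb N$ the fields $K^{p^n}$ and $k$ are linearly disjoint over $K^{p^n}\cap k$. *)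

theory Defs
  imports "HOL-Algebra.Algebra"
begin

unbundle cardinal_syntax

text \<open>
  An extension \<open>K/k\<close> is a field \<open>K\<close> (a ring record) with a subfield \<open>k\<close> of its carrier;
  intermediate fields are subsets of the carrier of \<open>K\<close>.
\<close>

text \<open>As in the library, the order of an element is 0 if it generates an infinite cyclic group.\<close>

definition ring_characteristic :: "('a, 'b) ring_scheme \<Rightarrow> nat" where
  "ring_characteristic R = group.ord (add_monoid R) \<one>\<^bsub>R\<^esub>"

definition power_set :: "('a, 'b) ring_scheme \<Rightarrow> nat \<Rightarrow> 'a set \<Rightarrow> 'a set" where
  "power_set R n E = (\<lambda>x. x [^]\<^bsub>R\<^esub> (ring_characteristic R ^ n)) ` E"

definition purely_inseparable :: "('a, 'b) ring_scheme \<Rightarrow> 'a set \<Rightarrow> bool" where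
  "purely_inseparable K k \<longleftrightarrow>
     (\<forall>x\<in>carrier K. \<exists>n::nat. x [^]\<^bsub>K\<^esub> (ring_characteristic K ^ n) \<in> k)"

definition root_field :: "('a, 'b) ring_scheme \<Rightarrow> 'a set \<Rightarrow> nat \<Rightarrow> 'a set" where
  "root_field K k n = {x \<in> carrier K. x [^]\<^bsub>K\<^esub> (ring_characteristic K ^ n) \<in> k}"

text \<open>\<open>B\<close> is an r-base of the extension \<open>E/k\<close>, where \<open>k\<close> and \<open>E\<close> are subfields of \<open>K\<close>.\<close>

definition r_base :: "('a, 'b) ring_scheme \<Rightarrow> 'a set \<Rightarrow> 'a set \<Rightarrow> 'a set \<Rightarrow> bool" where
  "r_base K k E B \<longleftrightarrow> B \<subseteq> E \<and>
     E = generate_field K (k \<union> power_set K 1 E \<union> B) \<and>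
     (\<forall>x\<in>B. x \<notin> generate_field K (k \<union> power_set K 1 E \<union> (B - {x})))"

definition is_card_sup :: "'a rel set \<Rightarrow> 'a rel \<Rightarrow> bool" where
  "is_card_sup S r \<longleftrightarrow> Card_order r \<and> (\<forall>s\<in>S. s \<le>o r) \<and>
     (\<forall>t::'a rel. Card_order t \<and> (\<forall>s\<in>S. s \<le>o t) \<longrightarrow> r \<le>o t)"

text \<open>
  Cardinals are represented by cardinal orders, so the supremum is unique only up to
  \<open>=o\<close>. It exists on the same type, because the cardinal of the universe is an upper bound.
\<close>

definition card_sup :: "'a rel set \<Rightarrow> 'a rel" where
  "card_sup S = (SOME r. is_card_sup S r)"

lemma is_card_sup_card_sup:
  fixes S :: "'a rel set"
  assumes "\<And>s. s \<in> S \<Longrightarrow> Card_order s"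
  shows "is_card_sup S (card_sup S)"
proof -
  define U where "U = {t::'a rel. Card_order t \<and> (\<forall>s\<in>S. s \<le>o t)}"
  have "|UNIV::'a set| \<in> U"
  proof -
    have "s \<le>o |UNIV::'a set|" if "s \<in> S" for s
      using assms[OF that] card_of_Field_ordIso card_of_mono1 ordIso_ordLeq_trans ordIso_symmetric
      by (metis subset_UNIV)
    then show ?thesis by (simp add: U_def card_of_Card_order)
  qed
  then obtain m where m: "m \<in> U" "\<And>t. (t, m) \<in> ordLess \<Longrightarrow> t \<notin> U"
    using wfE_min[OF wf_ordLess] by metis
  have "m \<le>o t" if "t \<in> U" for t
    using m that ordLess_or_ordLeq[of t m] unfolding U_def card_order_on_def by blast
  then have "is_card_sup S m"
    using m(1) unfolding is_card_sup_def U_def by blast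
  then show ?thesis unfolding card_sup_def by (rule someI)
qed

text \<open>
  All r-bases of a given extension are equipotent, so ranging over all of them instead
  of choosing one \<open>B\<^sub>n\<close> for each \<open>n\<close> does not affect the supremum.
\<close>

definition degree_of_irrationality :: "('a, 'b) ring_scheme \<Rightarrow> 'a set \<Rightarrow> 'a rel" where
  "degree_of_irrationality K k =
     card_sup {|B| | n B. n \<ge> 1 \<and> r_base K k (root_field K k n) B}"

definition q_finite :: "('a, 'b) ring_scheme \<Rightarrow> 'a set \<Rightarrow> bool" where
  "q_finite K k \<longleftrightarrow> finite (Field (degree_of_irrationality K k))"

definition lq_finite :: "('a, 'b) ring_scheme \<Rightarrow> 'a set \<Rightarrow> bool" where
  "lq_finite K k \<longleftrightarrow> (\<forall>n\<ge>1. ring.finite_dimension K k (root_field K k n))"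

text \<open>
  \<open>E\<close> and \<open>F\<close> are linearly disjoint over \<open>L\<close>: elements of \<open>E\<close> that are linearly independent
  over \<open>L\<close> remain so over \<open>F\<close>.
\<close>

definition linearly_disjoint ::
    "('a, 'b) ring_scheme \<Rightarrow> 'a set \<Rightarrow> 'a set \<Rightarrow> 'a set \<Rightarrow> bool" where
  "linearly_disjoint R L E F \<longleftrightarrow>
     (\<forall>Us. set Us \<subseteq> E \<and> ring.independent R L Us \<longrightarrow> ring.independent R F Us)"

definition modular_extension :: "('a, 'b) ring_scheme \<Rightarrow> 'a set \<Rightarrow> bool" where
  "modular_extension K k \<longleftrightarrow>
     (\<forall>n. linearly_disjoint K (power_set K n (carrier K) \<inter> k) (power_set K n (carrier K)) k)"

end

theory Submission
  imports Defs
begin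

text \<open>
  Fix \<open>n \<ge> 1\<close>, write \<open>L = k\<^sub>n\<close> and \<open>M = k(L\<^sup>p)\<close>, and count the degree of \<open>L/k\<close>, which is finite
  because the extension is \<open>lq\<close>-finite, along the two towers \<open>k \<subseteq> M \<subseteq> L\<close> and \<open>k \<subseteq> k\<^sub>1 \<subseteq> L\<close>:
  \<open>[L:M] [M:k] = [L:k\<^sub>1] [k\<^sub>1:k]\<close>.

  Frobenius carries \<open>L/k\<^sub>1\<close> isomorphically onto \<open>L\<^sup>p/k\<^sub>1\<^sup>p\<close>, and \<open>k\<^sub>1\<^sup>p = K\<^sup>p \<inter> k\<close>. Modularity says
  that \<open>K\<^sup>p\<close> and \<open>k\<close> are linearly disjoint over this field, so the \<open>p\<close>-th powers of a basis of
  \<open>L/k\<^sub>1\<close>, which lie in \<open>M\<close>, are independent over \<open>k\<close>. Hence \<open>[L:k\<^sub>1] \<le> [M:k]\<close>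
  (\<open>dimension_le_of_linearly_disjoint\<close>), and therefore \<open>[L:M] \<le> [k\<^sub>1:k]\<close>.

  An r-base of \<open>L/k\<close> is linearly independent over \<open>M\<close> (\<open>independent_of_not_generated\<close>), so it has
  at most \<open>[k\<^sub>1:k]\<close> elements. This bound does not depend on \<open>n\<close>, so the supremum is finite. (The
  sharp bound is the base-\<open>p\<close> logarithm of \<open>[k\<^sub>1:k]\<close>, but finiteness is all that is at stake.)
\<close>

section \<open>The Frobenius endomorphism\<close>

lemma (in cring) binomial_theorem:
  assumes a: "a \<in> carrier R" and b: "b \<in> carrier R"
  shows "(a \<oplus> b) [^] n = (\<Oplus>k\<in>{..n}. add_pow R (n choose k) (a [^] k \<otimes> b [^] (n - k)))"
proof (induction n)
  case 0
  then show ?case by simp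
next
  case (Suc n)
  let ?t = "\<lambda>k. a [^] k \<otimes> b [^] (Suc n - k)"
  have t: "?t k \<in> carrier R" for k using a b by simp
  have left: "(\<Oplus>k\<in>{..n}. add_pow R (n choose k) (a [^] k \<otimes> b [^] (n - k))) \<otimes> a =
        (\<Oplus>k\<in>{..n}. add_pow R (n choose k) (?t (Suc k)))"
    using a b
    by (subst finsum_ldistr, simp, simp, simp, intro finsum_cong')
      (auto simp: add_pow_ldistr add_pow_rdistr m_ac nat_pow_Suc)
  have right: "(\<Oplus>k\<in>{..n}. add_pow R (n choose k) (a [^] k \<otimes> b [^] (n - k))) \<otimes> b =
        (\<Oplus>k\<in>{..n}. add_pow R (n choose k) (?t k))"
    using a b
    by (subst finsum_ldistr, simp, simp, simp, intro finsum_cong')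
      (auto simp: add_pow_ldistr add_pow_rdistr m_ac nat_pow_Suc Suc_diff_le)
  have shift: "(\<Oplus>k\<in>{..n}. add_pow R (n choose k) (?t k)) =
        (\<Oplus>k\<in>{..n}. add_pow R (n choose Suc k) (?t (Suc k))) \<oplus> ?t 0"
  proof -
    have "(\<Oplus>k\<in>{..n}. add_pow R (n choose k) (?t k)) = (\<Oplus>k\<in>{..Suc n}. add_pow R (n choose k) (?t k))"
      using t a b by (subst finsum_Suc) (auto simp: binomial_eq_0)
    also have "\<dots> = (\<Oplus>k\<in>{..n}. add_pow R (n choose Suc k) (?t (Suc k))) \<oplus> ?t 0"
      using t a b by (subst finsum_Suc2) auto
    finally show ?thesis .
  qed
  have pascal: "add_pow R (n choose k) x \<oplus> add_pow R (n choose Suc k) x = add_pow R (Suc n choose Suc k) x"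
    if "x \<in> carrier R" for k x
    using add.nat_pow_mult[OF that, of "n choose k" "n choose Suc k"] by simp
  have "(a \<oplus> b) [^] Suc n = (\<Oplus>k\<in>{..n}. add_pow R (n choose k) (?t (Suc k))) \<oplus>
        (\<Oplus>k\<in>{..n}. add_pow R (n choose k) (?t k))"
    unfolding left[symmetric] right[symmetric] unfolding nat_pow_Suc Suc.IH
    using a b by (intro r_distr finsum_closed) auto
  also have "\<dots> = ((\<Oplus>k\<in>{..n}. add_pow R (n choose k) (?t (Suc k))) \<oplus>
        (\<Oplus>k\<in>{..n}. add_pow R (n choose Suc k) (?t (Suc k)))) \<oplus> ?t 0"
    unfolding shift using t a b by (intro a_assoc[symmetric] finsum_closed) auto
  also have "(\<Oplus>k\<in>{..n}. add_pow R (n choose k) (?t (Suc k))) \<oplus>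
        (\<Oplus>k\<in>{..n}. add_pow R (n choose Suc k) (?t (Suc k))) =
        (\<Oplus>k\<in>{..n}. add_pow R (Suc n choose Suc k) (?t (Suc k)))"
    using t by (subst finsum_addf[symmetric]) (auto simp only: pascal intro!: add.nat_pow_closed)
  also have "\<dots> \<oplus> ?t 0 = (\<Oplus>k\<in>{..Suc n}. add_pow R (Suc n choose k) (?t k))"
    using t a b by (subst finsum_Suc2) auto
  finally show ?case .
qed

lemma (in ring) add_pow_characteristic_multiple:
  assumes "x \<in> carrier R" "ring_characteristic R dvd n"
  shows "add_pow R n x = \<zero>"
proof -
  have "add_pow R n \<one> = \<zero>"
    using assms add.pow_eq_id[of \<one> n] by (simp add: ring_characteristic_def)
  then show ?thesis
    using add_pow_ldistr[of \<one> x n] assms by simp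
qed

lemma (in domain) ring_characteristic_prime:
  assumes "ring_characteristic R > 0"
  shows "Factorial_Ring.prime (ring_characteristic R)"
proof -
  let ?p = "ring_characteristic R"
  have zero_iff: "add_pow R n \<one> = \<zero> \<longleftrightarrow> ?p dvd n" for n :: nat
    using add.pow_eq_id[of \<one> n] by (simp add: ring_characteristic_def)
  have "?p \<noteq> 1"
    using zero_iff[of 1] by auto
  moreover have "?p dvd m \<or> ?p dvd n" if "?p dvd m * n" for m n
  proof -
    have "add_pow R m \<one> \<otimes> add_pow R n \<one> = add_pow R (m * n) \<one>"
      using add_pow_ldistr[of \<one> "add_pow R n \<one>" m] add.nat_pow_pow[of \<one> m n]
      by (simp add: mult.commute[of n m])
    then have "add_pow R m \<one> = \<zero> \<or> add_pow R n \<one> = \<zero>"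
      using that zero_iff[of "m * n"] integral_iff[of "add_pow R m \<one>" "add_pow R n \<one>"] by auto
    then show ?thesis by (simp add: zero_iff)
  qed
  ultimately have "Factorial_Ring.prime_elem ?p"
    using assms by (intro prime_elemI) auto
  then show ?thesis unfolding normalization_semidom_class.prime_def by simp
qed

text \<open>
  The inner binomial coefficients are divisible by \<open>p\<close>, so they kill every ring element.
\<close>

lemma (in cring) frobenius_add:
  assumes p: "Factorial_Ring.prime p" "ring_characteristic R = p"
    and a: "a \<in> carrier R" and b: "b \<in> carrier R"
  shows "(a \<oplus> b) [^] p = a [^] p \<oplus> b [^] p"
proof -
  let ?t = "\<lambda>k. add_pow R (p choose k) (a [^] k \<otimes> b [^] (p - k))"
  obtain q where q: "p = Suc q" using prime_gt_0_nat[OF p(1)] by (cases p) auto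
  have t: "?t k \<in> carrier R" for k using a b by simp
  have zero: "?t k = \<zero>" if "0 < k" "k < p" for k
    using that dvd_choose_prime[of k p] p a b by (intro add_pow_characteristic_multiple) auto
  have mid: "(\<Oplus>k\<in>{..q}. ?t k) = ?t 0"
  proof -
    have "(\<Oplus>k\<in>{..q}. ?t k) = (\<Oplus>k\<in>{..q}. if 0 = k then ?t k else \<zero>)"
      using zero t a b by (intro finsum_cong') (auto simp: q simp del: binomial_Suc_Suc nat_pow_Suc)
    also have "\<dots> = ?t 0" using t by (intro add.finprod_singleton) auto
    finally show ?thesis .
  qed
  have "(a \<oplus> b) [^] p = (\<Oplus>k\<in>{..Suc q}. ?t k)"
    unfolding binomial_theorem[OF a b] q ..
  also have "\<dots> = ?t p \<oplus> ?t 0"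
    using t mid by (subst finsum_Suc) (auto simp: q)
  finally show ?thesis using a b by simp
qed

lemma (in cring) frobenius_hom:
  assumes "Factorial_Ring.prime (ring_characteristic R)"
  shows "ring_hom_ring R R (\<lambda>x. x [^] (ring_characteristic R ^ n))"
proof -
  let ?p = "ring_characteristic R"
  have "(a \<oplus> b) [^] (?p ^ n) = a [^] (?p ^ n) \<oplus> b [^] (?p ^ n)"
    if "a \<in> carrier R" "b \<in> carrier R" for a b
  proof (induction n)
    case 0
    then show ?case using that by simp
  next
    case (Suc n)
    have pow: "x [^] (?p ^ Suc n) = (x [^] (?p ^ n)) [^] ?p" if "x \<in> carrier R" for x
      using that by (simp add: nat_pow_pow mult.commute)
    show ?case
      using that Suc.IH frobenius_add[OF assms refl] by (simp only: pow a_closed nat_pow_closed)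
  qed
  then show ?thesis
    by (intro ring_hom_ringI2 ring_axioms ring_hom_memI) (auto simp: nat_pow_distrib)
qed

lemma (in ring_hom_ring) vimage_is_subfield:
  assumes "field R" "field S" "subfield k S"
  shows "subfield {x \<in> carrier R. h x \<in> k} R"
proof -
  interpret R: field R by fact
  interpret S: field S by fact
  note k = subringE[OF subfieldE(1)[OF assms(3)]]
  have inv: "h (inv\<^bsub>R\<^esub> x) \<in> k" if x: "x \<in> carrier R" "h x \<in> k" "x \<noteq> \<zero>\<^bsub>R\<^esub>" for x
  proof -
    have u: "x \<in> Units R" using x R.field_Units by auto
    have "h x \<otimes>\<^bsub>S\<^esub> h (inv\<^bsub>R\<^esub> x) = \<one>\<^bsub>S\<^esub>"
      using x u by (metis R.Units_inv_closed R.Units_r_inv hom_mult hom_one)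
    moreover from this have "h x \<noteq> \<zero>\<^bsub>S\<^esub>"
      using u by auto
    ultimately have "h (inv\<^bsub>R\<^esub> x) = inv\<^bsub>S\<^esub> (h x)"
      using u x by (metis S.comm_inv_char R.Units_inv_closed hom_closed)
    then show ?thesis
      using S.subfield_m_inv(1)[OF assms(3)] x \<open>h x \<noteq> \<zero>\<^bsub>S\<^esub>\<close> by auto
  qed
  show ?thesis
    using k inv R.field_Units
    by (intro R.subfieldI' R.subringI) auto
qed

section \<open>Degrees in towers and independence\<close>

text \<open>
  The converse of \<open>telescopic_base\<close>: finiteness of the whole tower passes to both steps. A finite
  spanning list of \<open>L\<close> over \<open>k\<close> also spans \<open>L\<close> over \<open>M\<close>.
\<close>

lemma (in ring) dimension_tower_split:
  assumes k: "subfield k R" and M: "subfield M R" and sub: "k \<subseteq> M" "M \<subseteq> L"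
    and L: "subring L R" and d: "finite_dimension k L"
  obtains a b where "dimension a k M" "dimension b M L" "dimension (a * b) k L"
proof -
  have LR: "L \<subseteq> carrier R" using subringE(1)[OF L] .
  have alg: "subalgebra F V R" if "F \<subseteq> V" "subring V R" for F V
    using that subringE[OF that(2)] subring.axioms(1)[OF that(2)]
    unfolding subalgebra_def subalgebra_axioms_def by auto
  have fM: "finite_dimension k M"
    using subalbegra_incl_imp_finite_dimension[OF k d alg[OF sub(1)] sub(2)] subfieldE(1)[OF M] by auto
  obtain n where "dimension n k L" using d by auto
  then obtain Us where Us: "set Us \<subseteq> carrier R" "Span k Us = L"
    using exists_base[OF k] by blast
  have UsL: "set Us \<subseteq> L" using Span_base_incl[OF k Us(1)] Us(2) by simp
  have "Span M Us \<subseteq> L"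
    using subalgebra_Span_incl[OF M alg[OF sub(2) L] UsL] .
  moreover have "L \<subseteq> Span M Us"
    unfolding Us(2)[symmetric]
    using subalgebra_Span_incl[OF k _ Span_base_incl[OF M Us(1)]] Span_is_subalgebra[OF M Us(1)] sub(1)
    unfolding subalgebra_def subalgebra_axioms_def by blast
  ultimately have fL: "finite_dimension M L"
    using Span_finite_dimension[OF M Us(1)] by simp
  from fM fL obtain a b where ab: "dimension a k M" "dimension b M L"
    unfolding finite_dimension_def by blast
  show thesis
    using that[OF ab telescopic_base[OF k M ab]] .
qed

text \<open>
  A linear relation over the field generated by \<open>H\<close> in which \<open>x \<in> B\<close> occurs would express \<open>x\<close>
  as a field element generated by \<open>H\<close> and the rest of \<open>B\<close>: field-theoretic irredundancy is stronger
  than linear independence.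
\<close>

lemma (in field) independent_of_not_generated:
  assumes H: "H \<subseteq> carrier R" and B: "B \<subseteq> carrier R"
    and free: "\<And>x. x \<in> B \<Longrightarrow> x \<notin> generate_field R (H \<union> (B - {x}))"
    and "distinct Us" "set Us \<subseteq> B"
  shows "independent (generate_field R H) Us"
  using assms(4,5)
proof (induction Us)
  case Nil
  then show ?case by simp
next
  case (Cons x Us)
  let ?M = "generate_field R H" and ?N = "generate_field R (H \<union> (B - {x}))"
  have car: "H \<union> (B - {x}) \<subseteq> carrier R" using H B by auto
  have N: "subfield ?N R" by (rule generate_field_is_subfield[OF car])
  have M: "subfield ?M R" by (rule generate_field_is_subfield[OF H])
  have MN: "?M \<subseteq> ?N" by (rule mono_generate_field[OF _ car]) auto
  have "subalgebra ?M ?N R"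
    using MN subringE[OF subfieldE(1)[OF N]] subring.axioms(1)[OF subfieldE(1)[OF N]]
    unfolding subalgebra_def subalgebra_axioms_def by auto
  moreover have "set Us \<subseteq> ?N"
    using Cons.prems by (auto intro!: generate_field.incl)
  ultimately have "Span ?M Us \<subseteq> ?N"
    using subalgebra_Span_incl[OF M] by blast
  then have "x \<notin> Span ?M Us"
    using free[of x] Cons.prems by auto
  then show ?case
    using Cons B by (intro li_Cons) auto
qed

section \<open>Bounding the r-bases of the root fields\<close>

lemma (in field) root_field_subfield:
  assumes "Factorial_Ring.prime (ring_characteristic R)" "subfield k R"
  shows "subfield (root_field R k n) R"
proof -
  interpret F: ring_hom_ring R R "\<lambda>x. x [^] (ring_characteristic R ^ n)"
    by (rule frobenius_hom[OF assms(1)])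
  show ?thesis
    unfolding root_field_def
    using F.vimage_is_subfield[OF field_axioms field_axioms assms(2)] .
qed

lemma (in cring) root_field_mono:
  assumes "subring k R" "m \<le> n"
  shows "root_field R k m \<subseteq> root_field R k n"
proof
  fix x assume x: "x \<in> root_field R k m"
  let ?p = "ring_characteristic R"
  have pow: "y [^] (j::nat) \<in> k" if "y \<in> k" for y j
    using that subringE[OF assms(1)] by (induction j) auto
  have "x [^] (?p ^ n) = (x [^] (?p ^ m)) [^] (?p ^ (n - m))"
    using x assms(2) by (simp add: root_field_def nat_pow_pow flip: power_add)
  then show "x \<in> root_field R k n"
    using x pow by (auto simp: root_field_def)
qed

text \<open>
  This is where modularity enters: the \<open>p\<close>-th powers of a basis of \<open>L/k\<^sub>1\<close> are independent over
  \<open>k\<^sub>1\<^sup>p = K\<^sup>p \<inter> k\<close> because Frobenius is injective, hence over \<open>k\<close> by linear disjointness. Any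
  \<open>k\<close>-space \<open>M\<close> containing them thus has at least the dimension of \<open>L/k\<^sub>1\<close>.
\<close>

lemma (in field) dimension_le_of_linearly_disjoint:
  assumes p: "Factorial_Ring.prime (ring_characteristic R)" and k: "subfield k R"
    and disj: "linearly_disjoint R (power_set R 1 (carrier R) \<inter> k) (power_set R 1 (carrier R)) k"
    and L: "dimension e (root_field R k 1) L"
    and M: "dimension a k M" and sub: "power_set R 1 L \<subseteq> M"
  shows "e \<le> a"
proof -
  let ?h = "\<lambda>x. x [^] (ring_characteristic R ^ 1)"
  interpret F: ring_hom_ring R R ?h by (rule frobenius_hom[OF p])
  have k1: "subfield (root_field R k 1) R" by (rule root_field_subfield[OF p k])
  obtain Us where Us: "set Us \<subseteq> carrier R" "independent (root_field R k 1) Us" "length Us = e"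
      "Span (root_field R k 1) Us = L"
    using exists_base[OF k1 L] by blast
  have UsL: "set Us \<subseteq> L" using Span_base_incl[OF k1 Us(1)] Us(4) by simp
  have "inj_on ?h (carrier R)"
    by (rule F.img_is_subfield(1)[OF carrier_is_subfield]) simp
  then have "inj_on ?h (Span (root_field R k 1) Us)"
    by (rule inj_on_subset) (use Span_subgroup_props(1)[OF k1 Us(1)] in simp)
  then have "independent (?h ` root_field R k 1) (map ?h Us)"
    using F.inj_hom_preserves_independent[OF k1 _ _ Us(2)] by simp
  moreover have "?h ` root_field R k 1 = power_set R 1 (carrier R) \<inter> k"
    by (auto simp: root_field_def power_set_def)
  moreover have "set (map ?h Us) \<subseteq> power_set R 1 (carrier R)"
    using Us(1) by (auto simp: power_set_def)
  ultimately have "independent k (map ?h Us)"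
    using disj unfolding linearly_disjoint_def by metis
  moreover have "set (map ?h Us) \<subseteq> M"
    using UsL sub by (auto simp: power_set_def)
  ultimately show ?thesis
    using independent_length_le_dimension[OF k M] Us(3) by fastforce
qed

text \<open>
  The comparison of the towers through \<open>k(L\<^sup>p)\<close> and through \<open>k\<^sub>1\<close>, where \<open>L = k\<^sub>n\<close>. The bound \<open>c\<close>
  is the degree of \<open>k\<^sub>1/k\<close>, the same for all \<open>n\<close>.
\<close>

lemma (in field) r_base_root_field_card_le:
  assumes p: "Factorial_Ring.prime (ring_characteristic R)" and k: "subfield k R"
    and lq: "lq_finite R k"
    and disj: "linearly_disjoint R (power_set R 1 (carrier R) \<inter> k) (power_set R 1 (carrier R)) k"
    and c: "dimension c k (root_field R k 1)"
    and n: "n \<ge> 1" and B: "r_base R k (root_field R k n) B"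
  shows "finite B \<and> card B \<le> c"
proof -
  let ?L = "root_field R k n" and ?k1 = "root_field R k 1"
  let ?H = "k \<union> power_set R 1 ?L"
  let ?M = "generate_field R ?H"
  have L: "subfield ?L R" and k1: "subfield ?k1 R"
    using root_field_subfield[OF p k] by blast+
  note Lr = subringE[OF subfieldE(1)[OF L]]
  note kr = subringE[OF subfieldE(1)[OF k]]
  have fin: "finite_dimension k ?L" using lq n unfolding lq_finite_def by blast
  have kk1: "k \<subseteq> ?k1"
  proof -
    have "k \<subseteq> root_field R k 0" using kr(1) by (auto simp: root_field_def)
    then show ?thesis using root_field_mono[OF subfieldE(1)[OF k], of 0 1] by simp
  qed
  have k1L: "?k1 \<subseteq> ?L" using root_field_mono[OF subfieldE(1)[OF k] n] .
  have pow: "y [^] (j::nat) \<in> ?L" if "y \<in> ?L" for y j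
    using that Lr by (induction j) auto
  have HL: "?H \<subseteq> ?L"
    using kk1 k1L pow by (auto simp: power_set_def)
  then have H: "?H \<subseteq> carrier R" using Lr(1) by blast
  have M: "subfield ?M R" by (rule generate_field_is_subfield[OF H])
  have kM: "k \<subseteq> ?M" and LpM: "power_set R 1 ?L \<subseteq> ?M"
    by (auto intro: generate_field.incl)
  have MsubL: "?M \<subseteq> ?L" by (rule generate_field_min_subfield1[OF H L HL])
  obtain a b where ab: "dimension a k ?M" "dimension b ?M ?L" "dimension (a * b) k ?L"
    using dimension_tower_split[OF k M kM MsubL subfieldE(1)[OF L] fin] .
  obtain c' e where ce: "dimension c' k ?k1" "dimension e ?k1 ?L" "dimension (c' * e) k ?L"
    using dimension_tower_split[OF k k1 kk1 k1L subfieldE(1)[OF L] fin] .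
  have c': "c' = c" using dimension_is_inj[OF k ce(1) c] .
  have "a * b = c * e" using dimension_is_inj[OF k ab(3) ce(3)] c' by simp
  moreover have "e \<le> a"
    by (rule dimension_le_of_linearly_disjoint[OF p k disj ce(2) ab(1) LpM])
  \<comment> \<open>The factor \<open>a\<close> can be cancelled from \<open>a * b \<le> a * c\<close>.\<close>
  moreover have "a \<noteq> 0"
    using dimension_zero[OF k, of ?M] ab(1) generate_field.one[of R ?H] by (metis one_not_zero singletonD)
  ultimately have bc: "b \<le> c"
    by (metis mult.commute mult_le_cancel1 mult_le_mono2 neq0_conv)
  have BL: "B \<subseteq> ?L" and free: "\<And>x. x \<in> B \<Longrightarrow> x \<notin> generate_field R (?H \<union> (B - {x}))"
    using B unfolding r_base_def by auto
  \<comment> \<open>Independence concerns lists, so the bound is first obtained for finite subsets of \<open>B\<close>.\<close>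
  have card_le: "card A \<le> b" if A: "finite A" "A \<subseteq> B" for A
  proof -
    obtain Us where Us: "set Us = A" "distinct Us"
      using finite_distinct_list[OF A(1)] by blast
    have "independent ?M Us"
      using independent_of_not_generated[OF H _ free Us(2)] BL Lr(1) A(2) Us(1) by blast
    then have "length Us \<le> b"
      using independent_length_le_dimension[OF M ab(2)] BL A(2) Us(1) by blast
    then show ?thesis using Us distinct_card by metis
  qed
  have "finite B"
  proof (rule ccontr)
    assume "infinite B"
    then obtain A where "finite A" "card A = Suc b" "A \<subseteq> B"
      using infinite_arbitrarily_large by blast
    then show False using card_le[of A] by simp
  qed
  then show ?thesis using card_le[of B] bc by simp
qed

lemma finite_card_sup:
  fixes S :: "'a rel set" and t :: "'a rel"
  assumes "\<And>s. s \<in> S \<Longrightarrow> Card_order s" "Card_order t" "finite (Field t)"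
    "\<And>s. s \<in> S \<Longrightarrow> s \<le>o t"
  shows "finite (Field (card_sup S))"
proof -
  have "card_sup S \<le>o t"
    using is_card_sup_card_sup[of S] assms(1,2,4) unfolding is_card_sup_def by simp
  then show ?thesis
    by (rule card_of_ordLeq_finite[OF card_of_mono2 assms(3)])
qed

theorem proposition8p16:
  fixes K :: "('a, 'b) ring_scheme" and k :: "'a set"
  assumes "field K"
    and "ring_characteristic K > 0"
    and "subfield k K"
    and "purely_inseparable K k"
    and "lq_finite K k"
    and "modular_extension K k"
  shows "q_finite K k"
proof -
  interpret field K by fact
  have p: "Factorial_Ring.prime (ring_characteristic K)"
    by (rule ring_characteristic_prime[OF assms(2)])
  have disj: "linearly_disjoint K (power_set K 1 (carrier K) \<inter> k) (power_set K 1 (carrier K)) k"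
    using assms(6) unfolding modular_extension_def by blast
  obtain c where c: "dimension c k (root_field K k 1)"
    using assms(5) unfolding lq_finite_def by auto
  then obtain Us where Us: "independent k Us" "length Us = c"
    using exists_base[OF assms(3)] by blast
  have card_Us: "card (set Us) = c"
    using distinct_card[OF independent_distinct[OF assms(3) Us(1)]] Us(2) by simp
  \<comment> \<open>The upper bound for the supremum must be a cardinal on the type of the elements of \<open>K\<close>;
    a basis of \<open>k\<^sub>1/k\<close> supplies one of size \<open>c\<close>.\<close>
  have "|B| \<le>o |set Us|" if "n \<ge> 1" "r_base K k (root_field K k n) B" for n B
  proof -
    have "finite B" "card B \<le> card (set Us)"
      using r_base_root_field_card_le[OF p assms(3,5) disj c that] card_Us by auto
    then have "\<exists>f. f ` B \<subseteq> set Us \<and> inj_on f B"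
      using card_le_inj[of B "set Us"] by simp
    then show ?thesis
      using card_of_ordLeq[of B "set Us"] by blast
  qed
  then show ?thesis
    unfolding q_finite_def degree_of_irrationality_def
    by (intro finite_card_sup[where t = "|set Us|"]) (auto simp: card_of_Card_order)
qed

end
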